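(* For every integer $n\geq 4$, \[|\mathrm{VPF}_n^{\downarrow}| = 2\,|\mathrm{VPF}_{n-1}^{\downarrow}| + |\mathrm{VPF}_{n-3}^{\downarrow}|,\] and $|\mathrm{VPF}_1^{\downarrow}|=1$, $|\mathrm{VPF}_2^{\downarrow}|=3$, $|\mathrm{VPF}_3^{\downarrow}|=6$.
   Context: For $n\in\mathbb{N}$ let $[n]=\{1,\dots,n\}$. A preference list $\alpha=(a_1,\dots,a_n)\in[n]^n$ describes $n$ cars entering, in order $i=1,\dots,n$, a one-way street with spots $1,\dots,n$; car $i$ prefers spot $a_i$. Under the vacillating parking rule, car $i$ parks in spot $a_i$ if unoccupied; otherwise in spot $a_i-1$ if it exists and is unoccupied; otherwise in spot $a_i+1$ if it exists and is unoccupied; otherwise it fails to park. If all cars park, $\alpha$ is a vacillating parking function of length $n$. $\mathrm{VPF}_n^{\downarrow}$ denotes the set of vacillating parking functions $(b_1,\dots,b_n)$ of length $n$ with $b_1\geq b_2\geq\cdots\geq b_n$. *)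

theory Defs
  imports Main
begin

text \<open>
  \<open>vac_spot n S a\<close> is the spot in which a car with preference \<open>a\<close> parks when \<open>S\<close> is the set of
  occupied spots on a street with spots \<open>1, \<dots>, n\<close>; \<open>None\<close> means that the car fails to park.
  For \<open>a = 1\<close> the truncated difference \<open>a - 1\<close> is \<open>0\<close>, which is not a spot.
\<close>

definition vac_spot :: "nat \<Rightarrow> nat set \<Rightarrow> nat \<Rightarrow> nat option" where
  "vac_spot n S a =
     (if a \<notin> S then Some a
      else if a - 1 \<in> {1..n} \<and> a - 1 \<notin> S then Some (a - 1)
      else if a + 1 \<in> {1..n} \<and> a + 1 \<notin> S then Some (a + 1)
      else None)"

primrec all_park :: "nat \<Rightarrow> nat set \<Rightarrow> nat list \<Rightarrow> bool" where
  "all_park n S [] \<longleftrightarrow> True"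
| "all_park n S (a # as) \<longleftrightarrow>
     (case vac_spot n S a of None \<Rightarrow> False | Some p \<Rightarrow> all_park n (insert p S) as)"

definition VPF :: "nat \<Rightarrow> nat list set" where
  "VPF n = {as. length as = n \<and> set as \<subseteq> {1..n} \<and> all_park n {} as}"

definition VPF_decr :: "nat \<Rightarrow> nat list set" where
  "VPF_decr n = {bs \<in> VPF n. sorted_wrt (\<ge>) bs}"

end

theory Submission
  imports Defs
begin

text \<open>
  Consider a weakly decreasing list at a moment when exactly the spots \<open>1, \<dots>, k\<close> are free. The
  next car must prefer \<open>k + 1\<close>, \<open>k\<close> or \<open>k - 1\<close>. In the first two cases it parks in \<open>k\<close>. In the
  third case spot \<open>k\<close> can still be filled only if the next two cars prefer \<open>k - 1\<close> as well, so
  that these three cars fill \<open>k - 1\<close>, \<open>k - 2\<close>, \<open>k\<close> in this order (for \<open>k = 2\<close> two cars suffice).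
  Hence the number \<open>f k\<close> of completions satisfies \<open>f k = 2 f (k - 1) + f (k - 3)\<close> for \<open>k \<ge> 3\<close>.
  At the start the preference \<open>k + 1\<close> does not exist, so for \<open>n \<ge> 3\<close> the number of lists of
  length \<open>n\<close> is \<open>f (n - 1) + f (n - 3)\<close>, which inherits the recurrence.
\<close>

section \<open>Completions of a partially filled street\<close>

text \<open>\<open>m\<close> cars remain and \<open>x\<close> caps their preferences.
  \<open>S\<close> is arbitrary, as the sets \<open>{k<..N}\<close> miss the states in which a spot
  is still free above an occupied one.\<close>

definition completions :: "nat \<Rightarrow> nat set \<Rightarrow> nat \<Rightarrow> nat \<Rightarrow> nat list set" where
  "completions N S m x =
     {as. length as = m \<and> set as \<subseteq> {1..x} \<and> sorted_wrt (\<ge>) as \<and> all_park N S as}"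

text \<open>\<open>{n<..n}\<close> is empty; this form makes the start the case \<open>k = N\<close>
  of \<open>{k<..N}\<close>.\<close>

lemma VPF_decr_eq_completions: "VPF_decr n = completions n {n<..n} n n"
  by (auto simp: VPF_decr_def VPF_def completions_def)

lemma completions_0: "completions N S 0 x = {[]}"
  by (auto simp: completions_def)

lemma finite_completions: "finite (completions N S m x)"
  by (rule finite_subset[OF _ finite_lists_length_eq[of "{1..x}" m]])
    (auto simp: completions_def)

lemma Cons_in_completions_iff:
  "a # as \<in> completions N S (Suc m) x \<longleftrightarrow>
     1 \<le> a \<and> a \<le> x \<and> (\<exists>p. vac_spot N S a = Some p \<and> as \<in> completions N (insert p S) m a)"
  by (force simp: completions_def split: option.splits)

lemma in_completions_SucE:
  assumes "as \<in> completions N S (Suc m) x"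
  obtains a bs p where "as = a # bs" "1 \<le> a" "a \<le> x" "vac_spot N S a = Some p"
    "bs \<in> completions N (insert p S) m a"
proof (cases as)
  case Nil
  with assms show ?thesis by (simp add: completions_def)
next
  case (Cons a bs)
  with assms that show ?thesis by (auto simp: Cons_in_completions_iff)
qed

lemma vac_spot_SomeD:
  assumes "vac_spot N S a = Some p" "1 \<le> a" "a \<le> N"
  shows "p \<in> {1..N} - S" "p \<le> a + 1"
  using assms by (auto simp: vac_spot_def split: if_splits)

text \<open>With as many cars as free spots every free spot gets filled, and a car reaches at most one
  spot above its preference.\<close>

lemma free_spot_le:
  assumes "as \<in> completions N S m x" "x \<le> N" "S \<subseteq> {1..N}" "m + card S = N" "p \<in> {1..N} - S"
  shows "p \<le> x + 1"
  using assms
proof (induction m arbitrary: as S x)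
  case 0
  then have "S = {1..N}"
    by (intro card_subset_eq) auto
  with 0 show ?case by simp
next
  case (Suc m)
  obtain a bs q where q: "as = a # bs" "1 \<le> a" "a \<le> x" "vac_spot N S a = Some q"
    "bs \<in> completions N (insert q S) m a"
    by (rule in_completions_SucE[OF Suc.prems(1)])
  have *: "q \<in> {1..N} - S" "q \<le> a + 1"
    using vac_spot_SomeD[OF q(4,2)] q(3) Suc.prems(2) by auto
  show ?case
  proof (cases "p = q")
    case True
    with * q(3) show ?thesis by simp
  next
    case False
    have "finite S"
      using Suc.prems(3) finite_subset by blast
    with * Suc.prems q(3) False have "p \<le> a + 1"
      by (intro Suc.IH[OF q(5)]) auto
    with q(3) show ?thesis by simp
  qed
qed

section \<open>Splitting by the first preference\<close>

text \<open>The cars park in \<open>k + 2\<close>, \<open>k + 1\<close>, \<open>k + 3\<close>. The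
  cap stays at their preference \<open>k + 2\<close>, two above \<open>k\<close>.\<close>

lemma triple_iff:
  assumes "k + 3 \<le> N"
  shows "[k + 2, k + 2, k + 2] @ cs \<in> completions N {k + 3<..N} (k + 3) (k + 3) \<longleftrightarrow>
    cs \<in> completions N {k<..N} k (k + 2)"
proof -
  have S: "insert (k + 3) (insert (k + 1) (insert (k + 2) {k + 3<..N})) = {k<..N}"
    using assms by auto
  have "vac_spot N {k + 3<..N} (k + 2) = Some (k + 2)"
    "vac_spot N (insert (k + 2) {k + 3<..N}) (k + 2) = Some (k + 1)"
    "vac_spot N (insert (k + 1) (insert (k + 2) {k + 3<..N})) (k + 2) = Some (k + 3)"
    using assms by (auto simp: vac_spot_def)
  then show ?thesis
    using S by (simp add: Cons_in_completions_iff eval_nat_numeral)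
qed

lemma vac_spot_top_free: "k \<ge> 1 \<Longrightarrow> k \<le> N \<Longrightarrow> vac_spot N {k<..N} k = Some k"
  by (simp add: vac_spot_def)

lemma insert_top_free: "Suc k \<le> N \<Longrightarrow> insert (Suc k) {Suc k<..N} = {k<..N}"
  by auto

lemma top_Cons_iff:
  assumes "Suc k \<le> N"
  shows "Suc k # bs \<in> completions N {Suc k<..N} (Suc k) (Suc k) \<longleftrightarrow>
    bs \<in> completions N {k<..N} k (Suc k)"
  using assms by (simp add: Cons_in_completions_iff vac_spot_top_free insert_top_free)

text \<open>The car parks in its free preference \<open>a\<close>, so \<open>Suc k\<close> is still
  to be filled and \<open>free_spot_le\<close> forces \<open>Suc k \<le> a + 1\<close>.\<close>

lemma completions_below_top:
  assumes "a # bs \<in> completions N {Suc k<..N} (Suc k) (Suc k)" "a \<noteq> Suc k" "Suc k \<le> N"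
  shows "a = k" "1 \<le> k" "bs \<in> completions N (insert k {Suc k<..N}) k k"
proof -
  from assms have a: "1 \<le> a" "a \<le> k" "bs \<in> completions N (insert a {Suc k<..N}) k a"
    by (auto simp: Cons_in_completions_iff vac_spot_def)
  have "Suc k \<le> a + 1"
    by (rule free_spot_le[OF a(3)]) (use a assms in auto)
  with a show "a = k" "1 \<le> k" "bs \<in> completions N (insert k {Suc k<..N}) k k"
    by auto
qed

lemma completions_1:
  assumes "1 \<le> N"
  shows "completions N {1<..N} 1 1 = (#) 1 ` completions N {0<..N} 0 1"
proof (intro equalityI subsetI)
  fix as assume "as \<in> completions N {1<..N} 1 1"
  then show "as \<in> (#) 1 ` completions N {0<..N} 0 1"
    by (auto simp: completions_def length_Suc_conv)
next
  fix as assume "as \<in> (#) 1 ` completions N {0<..N} 0 1"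
  then show "as \<in> completions N {1<..N} 1 1"
    using top_Cons_iff[of 0 N] assms by auto
qed

text \<open>Spot 1 has no left neighbour, so a second car preferring 1 moves up to spot 2 at
  once.\<close>

lemma completions_2:
  assumes "2 \<le> N"
  shows "completions N {2<..N} 2 2 = (#) 2 ` completions N {1<..N} 1 2 \<union> {[1, 1]}"
proof (intro equalityI subsetI)
  fix as assume as: "as \<in> completions N {2<..N} 2 2"
  then obtain a bs where ab: "as = a # bs"
    by (cases as) (auto simp: completions_def)
  show "as \<in> (#) 2 ` completions N {1<..N} 1 2 \<union> {[1, 1]}"
  proof (cases "a = 2")
    case True
    then show ?thesis
      using as ab top_Cons_iff[of 1 N bs] assms by (auto simp: numeral_2_eq_2)
  next
    case False
    then have "a = 1" "bs \<in> completions N (insert 1 {2<..N}) 1 1"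
      using completions_below_top[of a bs N 1] as ab assms by (auto simp: numeral_2_eq_2)
    then show ?thesis
      using ab by (auto simp: completions_def length_Suc_conv)
  qed
next
  fix as assume "as \<in> (#) 2 ` completions N {1<..N} 1 2 \<union> {[1, 1]}"
  then show "as \<in> completions N {2<..N} 2 2"
  proof
    assume "as \<in> (#) 2 ` completions N {1<..N} 1 2"
    then show ?thesis
      using top_Cons_iff[of 1 N] assms by (auto simp: numeral_2_eq_2)
  next
    assume "as \<in> {[1, 1]}"
    then show ?thesis
      using assms by (auto simp: completions_def vac_spot_def)
  qed
qed

text \<open>While \<open>k + 3\<close> is free, \<open>free_spot_le\<close> keeps each preference at
  \<open>k + 2\<close> or above. If the first is \<open>k + 2\<close>, it also caps the others, and
  only the third car reaches \<open>k + 3\<close>.\<close>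

lemma completions_ge_3:
  assumes "k + 3 \<le> N"
  shows "completions N {k + 3<..N} (k + 3) (k + 3) =
    (#) (k + 3) ` completions N {k + 2<..N} (k + 2) (k + 3) \<union>
    (@) [k + 2, k + 2, k + 2] ` completions N {k<..N} k (k + 2)" (is "?C = ?A \<union> ?B")
proof (intro equalityI subsetI)
  fix as assume as: "as \<in> ?C"
  then obtain a bs where ab: "as = a # bs"
    by (cases as) (auto simp: completions_def)
  show "as \<in> ?A \<union> ?B"
  proof (cases "a = k + 3")
    case True
    then show ?thesis
      using as ab top_Cons_iff[of "k + 2" N bs] assms by (auto simp: eval_nat_numeral)
  next
    case False
    then have a: "a = k + 2"
      and bs: "bs \<in> completions N (insert (k + 2) {k + 3<..N}) (Suc (Suc k)) (k + 2)"
      using completions_below_top[of a bs N "k + 2"] as ab assms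
      by (auto simp: eval_nat_numeral)
    obtain b cs p where b: "bs = b # cs" "1 \<le> b" "b \<le> k + 2"
      "vac_spot N (insert (k + 2) {k + 3<..N}) b = Some p"
      "cs \<in> completions N (insert p (insert (k + 2) {k + 3<..N})) (Suc k) b"
      by (rule in_completions_SucE[OF bs])
    have p: "p \<le> k + 2" "1 \<le> p" "p \<noteq> k + 2"
      using b(2-4) assms by (auto simp: vac_spot_def split: if_splits)
    \<comment> \<open>The second car parks below \<open>k + 2\<close>, so \<open>k + 3\<close> is
      still free.\<close>
    have "k + 3 \<le> b + 1"
      by (rule free_spot_le[OF b(5)]) (use b(3) p assms in auto)
    with b(3) have b2: "b = k + 2" by simp
    with b(4) have p1: "p = k + 1"
      by (auto simp: vac_spot_def split: if_splits)
    obtain c ds q where c: "cs = c # ds" "1 \<le> c" "c \<le> k + 2"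
      "vac_spot N (insert (k + 1) (insert (k + 2) {k + 3<..N})) c = Some q"
      "ds \<in> completions N (insert q (insert (k + 1) (insert (k + 2) {k + 3<..N}))) k c"
      by (rule in_completions_SucE[OF b(5)[unfolded b2 p1]])
    have "c = k + 2"
    proof (rule ccontr)
      assume "c \<noteq> k + 2"
      \<comment> \<open>From \<open>k + 1\<close> the car cannot move up, since \<open>k + 2\<close>
        is occupied; it ends at \<open>k\<close> or below.\<close>
      with c(2-4) assms have q: "q \<le> k" "1 \<le> q"
        by (auto simp: vac_spot_def split: if_splits)
      have "k + 3 \<le> c + 1"
        by (rule free_spot_le[OF c(5)]) (use c(3) q assms in auto)
      with \<open>c \<noteq> k + 2\<close> c(3) show False by simp
    qed
    then have "as = [k + 2, k + 2, k + 2] @ ds"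
      using ab a b(1) b2 c(1) by simp
    then show ?thesis
      using as triple_iff[OF assms, of ds] by blast
  qed
next
  fix as assume "as \<in> ?A \<union> ?B"
  then show "as \<in> ?C"
  proof
    assume "as \<in> ?A"
    then show ?thesis
      using top_Cons_iff[of "k + 2" N] assms by (auto simp: eval_nat_numeral)
  next
    assume "as \<in> ?B"
    then show ?thesis
      using triple_iff[OF assms] by blast
  qed
qed

section \<open>Changing the preference cap\<close>

text \<open>The additional preference is an occupied spot whose left neighbour \<open>Suc k\<close>
  is free.\<close>

lemma completions_raise_bound:
  assumes "Suc (Suc k) \<le> N"
  shows "completions N {Suc k<..N} (Suc k) (Suc (Suc k)) =
    (#) (Suc (Suc k)) ` completions N {k<..N} k (Suc (Suc k)) \<union>
    completions N {Suc k<..N} (Suc k) (Suc k)" (is "?C = ?A \<union> ?B")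
proof -
  have v: "vac_spot N {Suc k<..N} (Suc (Suc k)) = Some (Suc k)"
    using assms by (auto simp: vac_spot_def)
  have I: "insert (Suc k) {Suc k<..N} = {k<..N}"
    using assms by auto
  show ?thesis
  proof (rule set_eqI)
    fix as
    show "as \<in> ?C \<longleftrightarrow> as \<in> ?A \<union> ?B"
    proof (cases as)
      case Nil
      then show ?thesis by (auto simp: completions_def)
    next
      case (Cons a bs)
      then show ?thesis
        using v I by (cases "a = Suc (Suc k)") (auto simp: Cons_in_completions_iff le_Suc_eq)
    qed
  qed
qed

text \<open>A car preferring \<open>k + 2\<close> fails: \<open>k + 1\<close> and
  \<open>k + 2\<close> are occupied, and \<open>k + 3\<close> is occupied or off the street.\<close>

lemma completions_bound_two_above:
  assumes "k + 2 \<le> N"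
  shows "completions N {k<..N} k (k + 2) = completions N {k<..N} k (k + 1)"
proof (cases k)
  case 0
  then show ?thesis by (simp add: completions_0)
next
  case (Suc m)
  have v: "vac_spot N {k<..N} (k + 2) = None"
    using assms by (auto simp: vac_spot_def)
  show ?thesis
  proof (rule set_eqI)
    fix as
    show "as \<in> completions N {k<..N} k (k + 2) \<longleftrightarrow> as \<in> completions N {k<..N} k (k + 1)"
    proof (cases as)
      case Nil
      then show ?thesis by (auto simp: completions_def)
    next
      case (Cons a bs)
      then show ?thesis
        using v Suc by (cases "a = k + 2") (auto simp: Cons_in_completions_iff le_Suc_eq)
    qed
  qed
qed

section \<open>Counting\<close>

fun num_completions :: "nat \<Rightarrow> nat" where
  "num_completions 0 = 1"
| "num_completions (Suc 0) = 2"
| "num_completions (Suc (Suc 0)) = 5"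
| "num_completions (Suc (Suc (Suc k))) = 2 * num_completions (Suc (Suc k)) + num_completions k"

fun num_decr :: "nat \<Rightarrow> nat" where
  "num_decr 0 = 1"
| "num_decr (Suc 0) = 1"
| "num_decr (Suc (Suc 0)) = 3"
| "num_decr (Suc (Suc (Suc k))) = num_completions (Suc (Suc k)) + num_completions k"

lemma num_completions_Suc: "num_completions (Suc k) = num_completions k + num_decr (Suc k)"
  by (cases k rule: num_decr.cases) simp_all

text \<open>\<open>num_decr\<close> is a sum of two shifts of \<open>num_completions\<close>, so the
  linear recurrence carries over; small \<open>k\<close> are checked separately.\<close>

lemma num_decr_rec: "num_decr (k + 4) = 2 * num_decr (k + 3) + num_decr (k + 1)"
  by (cases k rule: num_decr.cases) (simp_all add: eval_nat_numeral)

text \<open>With \<open>below\<close> as a hypothesis, this serves both the induction for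
  \<open>k < N\<close> and the initial state \<open>k = N\<close>, where no spot
  \<open>Suc k\<close> exists.\<close>

lemma card_completions_step:
  assumes below: "\<And>j. j < k \<Longrightarrow> card (completions N {j<..N} j (Suc j)) = num_completions j"
    and "k \<le> N"
  shows "card (completions N {k<..N} k k) = num_decr k"
proof (cases k rule: num_decr.cases)
  case 1
  then show ?thesis by (simp add: completions_0)
next
  case 2
  then show ?thesis
    using completions_1[of N] assms by (simp add: completions_0)
next
  case 3
  have "card ((#) 2 ` completions N {1<..N} 1 2 \<union> {[1, 1]}) =
      card ((#) 2 ` completions N {1<..N} 1 2) + card {[1, 1 :: nat]}"
    by (intro card_Un_disjoint) (auto simp: finite_completions)
  also have "\<dots> = 3"
    using below[of 1] 3 by (simp add: card_image numeral_2_eq_2)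
  finally show ?thesis
    using completions_2[of N] assms(2) 3 by (simp add: numeral_2_eq_2)
next
  case (4 j)
  let ?A = "(#) (j + 3) ` completions N {j + 2<..N} (j + 2) (j + 3)"
  let ?B = "(@) [j + 2, j + 2, j + 2] ` completions N {j<..N} j (j + 2)"
  have k: "k = j + 3" using 4 by simp
  have "card (completions N {k<..N} k k) = card (?A \<union> ?B)"
    using completions_ge_3[of j N] assms(2) k by simp
  also have "\<dots> = card ?A + card ?B"
    by (intro card_Un_disjoint) (auto simp: finite_completions)
  also have "card ?A = num_completions (j + 2)"
    using below[of "j + 2"] k by (simp add: card_image eval_nat_numeral)
  \<comment> \<open>The cap \<open>j + 2\<close> left by the triple drops to \<open>Suc j\<close>,
    as \<open>below\<close> requires.\<close>
  also have "card ?B = num_completions j"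
    using below[of j] k assms(2) completions_bound_two_above[of j N]
    by (subst card_image) (auto simp: inj_on_def)
  finally show ?thesis
    using 4 by (simp add: eval_nat_numeral)
qed

lemma card_completions:
  assumes "k < N"
  shows "card (completions N {k<..N} k (Suc k)) = num_completions k"
  using assms
proof (induction k rule: less_induct)
  case (less k)
  show ?case
  proof (cases k)
    case 0
    then show ?thesis by (simp add: completions_0)
  next
    case (Suc m)
    let ?A = "(#) (Suc (Suc m)) ` completions N {m<..N} m (Suc (Suc m))"
    let ?B = "completions N {Suc m<..N} (Suc m) (Suc m)"
    have "card (completions N {k<..N} k (Suc k)) = card (?A \<union> ?B)"
      using completions_raise_bound[of m N] less.prems Suc by simp
    also have "\<dots> = card ?A + card ?B"
      by (intro card_Un_disjoint finite_imageI finite_completions) (auto simp: completions_def)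
    also have "card ?A = num_completions m"
      using less.IH[of m] less.prems Suc completions_bound_two_above[of m N]
      by (simp add: card_image)
    also have "card ?B = num_decr (Suc m)"
      using less.IH less.prems Suc by (intro card_completions_step) auto
    finally show ?thesis
      using Suc num_completions_Suc by simp
  qed
qed

lemma card_VPF_decr: "card (VPF_decr n) = num_decr n"
  unfolding VPF_decr_eq_completions by (intro card_completions_step card_completions) auto

theorem theorem3p6:
  shows "(\<forall>n\<ge>4. card (VPF_decr n) = 2 * card (VPF_decr (n - 1)) + card (VPF_decr (n - 3))) \<and>
    card (VPF_decr 1) = 1 \<and> card (VPF_decr 2) = 3 \<and> card (VPF_decr 3) = 6"
proof (intro conjI allI impI)
  fix n :: nat
  assume "n \<ge> 4"
  then obtain k where "n = k + 4"
    by (metis add.commute le_Suc_ex)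
  then show "card (VPF_decr n) = 2 * card (VPF_decr (n - 1)) + card (VPF_decr (n - 3))"
    using num_decr_rec[of k] by (simp add: card_VPF_decr add.commute)
qed (simp_all add: card_VPF_decr eval_nat_numeral)

end
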